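(* Let $n\ge 4$, let $G=(V,E)$ be a graph with $n$ nodes and planted bisection $V_1,V_2$, and let $G_1=G[V_1]$, $G_2=G[V_2]$, and $G_0=(V,E_0)$ with $E_0$ the set of edges of $G$ between $V_1$ and $V_2$. Let $G_1$ and $G_2$ be $d_{\mathrm{in}}$-regular for some $d_{\mathrm{in}}\in\{1,\dots,\frac n2-1\}$ and let $G_0$ be $d_{\mathrm{out}}$-regular for some $d_{\mathrm{out}}\in\{0,\dots,\frac n2\}$. Then the cut vector $\bar x$ corresponding to the planted bisection is an optimal solution of the LP relaxation if $$d_{\mathrm{in}}-d_{\mathrm{out}}\ge \frac n4-1 .$$
   Context: Graphs are finite, simple and undirected, with $V=\{1,\dots,n\}$. A bisection of $V$ is a partition of $V$ into two subsets of equal cardinality (so $n$ is even); a fixed bisection $V_1,V_2$ is called the planted bisection. $G[U]$ denotes the subgraph induced by $U$. The LP relaxation (metric relaxation of the minimum bisection problem) associated with $G$ is the following linear program in $x\in\mathbb R^{\binom n2}$, with coordinates $x_{ij}$, $1\le i<j\le n$, and the convention $x_{ji}:=x_{ij}$: $$\min\ \sum_{1\le i<j\le n}a_{ij}x_{ij}$$ subject to $x_{ij}\le x_{ik}+x_{jk}$ for all distinct $i,j,k\in\{1,\dots,n\}$ with $i<j$; $x_{ij}+x_{ik}+x_{jk}\le 2$ for all $1\le i<j<k\le n$; and $\sum_{1\le i<j\le n}x_{ij}=n^2/4$. Here $a_{ij}=1$ if $\{i,j\}\in E$ and $a_{ij}=0$ otherwise. The cut vector corresponding to the planted bisection is $\bar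 x\in\{0,1\}^{\binom n2}$ with $\bar x_{ij}=0$ if $i,j$ are in the same set of the bisection and $\bar x_{ij}=1$ otherwise. *)

theory Defs
  imports Complex_Main "HOL-Library.Ramsey" "HOL-Library.FuncSet"
begin

text \<open>A finite simple undirected graph is given by its vertex set and a set of two-element subsets
  of it; \<^term>\<open>nsets V 2\<close> is the set of all two-element subsets of \<^term>\<open>V\<close>.\<close>

definition simple_graph :: "'a set \<Rightarrow> 'a set set \<Rightarrow> bool" where
  "simple_graph V E \<longleftrightarrow> finite V \<and> E \<subseteq> nsets V 2"

definition degree :: "'a set set \<Rightarrow> 'a \<Rightarrow> nat" where
  "degree E v = card {e \<in> E. v \<in> e}"

definition regular :: "'a set \<Rightarrow> 'a set set \<Rightarrow> nat \<Rightarrow> bool" where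
  "regular V E d \<longleftrightarrow> (\<forall>v\<in>V. degree E v = d)"

definition induced_edges :: "'a set set \<Rightarrow> 'a set \<Rightarrow> 'a set set" where
  "induced_edges E U = {e \<in> E. e \<subseteq> U}"

definition edges_between :: "'a set set \<Rightarrow> 'a set \<Rightarrow> 'a set \<Rightarrow> 'a set set" where
  "edges_between E U W = {e \<in> E. \<exists>u\<in>U. \<exists>w\<in>W. e = {u, w}}"

definition bisection :: "'a set \<Rightarrow> 'a set \<Rightarrow> 'a set \<Rightarrow> bool" where
  "bisection V V\<^sub>1 V\<^sub>2 \<longleftrightarrow> V\<^sub>1 \<union> V\<^sub>2 = V \<and> V\<^sub>1 \<inter> V\<^sub>2 = {} \<and> card V\<^sub>1 = card V\<^sub>2"

text \<open>A vector with one coordinate \<open>x\<^sub>i\<^sub>j\<close> for each \<open>1 \<le> i < j \<le> n\<close> is a function on the two-element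
  subsets of \<open>{1..n}\<close>, extensional outside of them. Its coordinate \<open>x\<^sub>i\<^sub>j\<close> is \<^term>\<open>x {i, j}\<close>, so the
  convention \<open>x\<^sub>j\<^sub>i = x\<^sub>i\<^sub>j\<close> is built in.\<close>

definition lp_feasible :: "nat \<Rightarrow> (nat set \<Rightarrow> real) \<Rightarrow> bool" where
  "lp_feasible n x \<longleftrightarrow>
     x \<in> nsets {1..n} 2 \<rightarrow>\<^sub>E UNIV \<and>
     (\<forall>i\<in>{1..n}. \<forall>j\<in>{1..n}. \<forall>k\<in>{1..n}. i < j \<and> k \<noteq> i \<and> k \<noteq> j \<longrightarrow>
        x {i, j} \<le> x {i, k} + x {j, k}) \<and>
     (\<forall>i\<in>{1..n}. \<forall>j\<in>{1..n}. \<forall>k\<in>{1..n}. i < j \<and> j < k \<longrightarrow>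
        x {i, j} + x {i, k} + x {j, k} \<le> 2) \<and>
     (\<Sum>e\<in>nsets {1..n} 2. x e) = (real n)\<^sup>2 / 4"

definition lp_objective :: "nat \<Rightarrow> nat set set \<Rightarrow> (nat set \<Rightarrow> real) \<Rightarrow> real" where
  "lp_objective n E x = (\<Sum>e\<in>nsets {1..n} 2. (if e \<in> E then 1 else 0) * x e)"

definition lp_optimal :: "nat \<Rightarrow> nat set set \<Rightarrow> (nat set \<Rightarrow> real) \<Rightarrow> bool" where
  "lp_optimal n E x \<longleftrightarrow> is_arg_min (lp_objective n E) (lp_feasible n) x"

definition cut_vector :: "nat \<Rightarrow> nat set \<Rightarrow> nat set \<Rightarrow> nat set \<Rightarrow> real" where
  "cut_vector n V\<^sub>1 V\<^sub>2 = (\<lambda>e\<in>nsets {1..n} 2. if e \<subseteq> V\<^sub>1 \<or> e \<subseteq> V\<^sub>2 then 0 else 1)"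

end

theory Submission
  imports Defs
begin

text \<open>Write \<open>n = 2 m\<close> and let \<open>x\<close> be a feasible point, viewed as a semimetric. Summing the triangle
  inequality \<open>x i k \<le> x i j + x j k\<close> over all \<open>k\<close> on one side, all \<open>G\<^sub>0\<close>-neighbours \<open>j\<close> of \<open>k\<close> and all
  \<open>i\<close> on the other side bounds the total length of the cross pairs by that of the cross edges and
  of the inner pairs. Inside a part, two non-adjacent vertices have at least
  \<open>2 d\<^sub>i\<^sub>n - (m - 2) \<ge> 2 d\<^sub>o\<^sub>u\<^sub>t\<close> common neighbours, so the triangle inequality through these bounds the
  total length of the inner pairs by that of the inner edges. Adding up, and using that the total
  length of all pairs is \<open>m\<^sup>2\<close>, every feasible point has objective value at least
  \<open>m d\<^sub>o\<^sub>u\<^sub>t\<close>, which is attained by the cut vector.\<close>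

section \<open>Sums over unordered pairs and neighbourhoods\<close>

text \<open>Double counting of the incidences between vertices and pairs: a pair is seen from both
  of its ends, and the pairs through \<open>i\<close> correspond to the other vertices
  \<open>j\<close>.\<close>

lemma sum_nsets_2:
  fixes f :: "'a set \<Rightarrow> real"
  assumes "finite V"
  shows "2 * (\<Sum>e\<in>nsets V 2. f e) = (\<Sum>i\<in>V. \<Sum>j\<in>V - {i}. f {i, j})"
proof -
  have fin: "finite (nsets V 2)"
    using assms by (rule finite_imp_finite_nsets)
  have "2 * (\<Sum>e\<in>nsets V 2. f e) = (\<Sum>e\<in>nsets V 2. \<Sum>i\<in>{i. i \<in> V \<and> i \<in> e}. f e)"
    unfolding sum_distrib_left
  proof (rule sum.cong[OF refl])
    fix e assume "e \<in> nsets V 2"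
    then have "{i. i \<in> V \<and> i \<in> e} = e" "card e = 2"
      by (auto simp: nsets_def)
    then show "2 * f e = (\<Sum>i\<in>{i. i \<in> V \<and> i \<in> e}. f e)"
      by simp
  qed
  also have "\<dots> = (\<Sum>i\<in>V. \<Sum>e\<in>{e. e \<in> nsets V 2 \<and> i \<in> e}. f e)"
    using fin assms by (rule sum.swap_restrict)
  also have "\<dots> = (\<Sum>i\<in>V. \<Sum>j\<in>V - {i}. f {i, j})"
  proof (rule sum.cong[OF refl])
    fix i assume i: "i \<in> V"
    have "bij_betw (\<lambda>j. {i, j}) (V - {i}) {e. e \<in> nsets V 2 \<and> i \<in> e}"
      unfolding bij_betw_def
    proof
      show "inj_on (\<lambda>j. {i, j}) (V - {i})"
        by (auto simp: inj_on_def doubleton_eq_iff)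
      show "(\<lambda>j. {i, j}) ` (V - {i}) = {e. e \<in> nsets V 2 \<and> i \<in> e}"
        using i by (auto simp: nsets_def card_2_iff doubleton_eq_iff image_iff)
    qed
    from sum.reindex_bij_betw[OF this, of f]
    show "(\<Sum>e\<in>{e. e \<in> nsets V 2 \<and> i \<in> e}. f e) = (\<Sum>j\<in>V - {i}. f {i, j})"
      by simp
  qed
  finally show ?thesis .
qed

section \<open>Neighbourhoods and degrees\<close>

definition nbrs :: "'a set set \<Rightarrow> 'a \<Rightarrow> 'a set" where
  "nbrs E v = {w. {v, w} \<in> E}"

lemma nbrs_sym: "w \<in> nbrs E v \<longleftrightarrow> v \<in> nbrs E w"
  by (simp add: nbrs_def insert_commute)

lemma nbrs_subset: "E \<subseteq> nsets V 2 \<Longrightarrow> nbrs E v \<subseteq> V - {v}"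
  by (auto simp: nbrs_def nsets_def)

lemma degree_eq_card_nbrs:
  assumes "E \<subseteq> nsets V 2"
  shows "degree E v = card (nbrs E v)"
proof -
  have "{e \<in> E. v \<in> e} = (\<lambda>w. {v, w}) ` nbrs E v"
  proof (intro set_eqI iffI)
    fix e assume e: "e \<in> {e \<in> E. v \<in> e}"
    then have "card e = 2"
      using assms by (auto simp: nsets_def)
    then obtain w where "e = {v, w}"
      using e by (auto simp: card_2_iff)
    then show "e \<in> (\<lambda>w. {v, w}) ` nbrs E v"
      using e by (auto simp: nbrs_def)
  qed (auto simp: nbrs_def)
  moreover have "inj_on (\<lambda>w. {v, w}) (nbrs E v)"
    by (auto simp: inj_on_def doubleton_eq_iff)
  ultimately show ?thesis
    by (simp add: degree_def card_image)
qed

lemma card_nbrs_induced: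
  assumes "E \<subseteq> nsets V 2" and "regular U (induced_edges E U) d" and "v \<in> U"
  shows "card (nbrs E v \<inter> U) = d"
proof -
  have "induced_edges E U \<subseteq> nsets V 2"
    using assms(1) by (auto simp: induced_edges_def)
  then have "card (nbrs (induced_edges E U) v) = d"
    using assms(2,3) by (simp add: degree_eq_card_nbrs regular_def)
  moreover have "nbrs (induced_edges E U) v = nbrs E v \<inter> U"
    using assms(3) by (auto simp: nbrs_def induced_edges_def)
  ultimately show ?thesis by simp
qed

lemma edges_between_commute: "edges_between E U W = edges_between E W U"
  by (fastforce simp: edges_between_def insert_commute)

lemma card_nbrs_between:
  assumes "E \<subseteq> nsets V 2" and "regular V (edges_between E U W) d"
    and "U \<inter> W = {}" and "U \<subseteq> V" and "v \<in> U"
  shows "card (nbrs E v \<inter> W) = d"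
proof -
  have "edges_between E U W \<subseteq> nsets V 2"
    using assms(1) by (auto simp: edges_between_def)
  then have "card (nbrs (edges_between E U W) v) = d"
    using assms(2,4,5) by (auto simp: degree_eq_card_nbrs regular_def)
  moreover have "nbrs (edges_between E U W) v = nbrs E v \<inter> W"
    using assms(3,5) by (auto simp: nbrs_def edges_between_def doubleton_eq_iff)
  ultimately show ?thesis by simp
qed

section \<open>Triangle inequalities in regular graphs\<close>

text \<open>The points in the triangle inequality may coincide, so sums need no side conditions.
  Nonnegativity is not listed because it follows from the case \<open>i = j\<close>.\<close>

definition semimetric_on :: "'a set \<Rightarrow> ('a \<Rightarrow> 'a \<Rightarrow> real) \<Rightarrow> bool" where
  "semimetric_on V D \<longleftrightarrow> (\<forall>i\<in>V. D i i = 0) \<and> (\<forall>i\<in>V. \<forall>j\<in>V. D i j = D j i)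
     \<and> (\<forall>i\<in>V. \<forall>j\<in>V. \<forall>k\<in>V. D i j \<le> D i k + D k j)"

lemma semimetric_on_subset: "semimetric_on V D \<Longrightarrow> U \<subseteq> V \<Longrightarrow> semimetric_on U D"
  unfolding semimetric_on_def by blast

lemma semimetric_on_refl: "semimetric_on V D \<Longrightarrow> i \<in> V \<Longrightarrow> D i i = 0"
  unfolding semimetric_on_def by blast

lemma semimetric_on_sym: "semimetric_on V D \<Longrightarrow> i \<in> V \<Longrightarrow> j \<in> V \<Longrightarrow> D i j = D j i"
  unfolding semimetric_on_def by blast

lemma semimetric_on_triangle:
  "semimetric_on V D \<Longrightarrow> i \<in> V \<Longrightarrow> j \<in> V \<Longrightarrow> k \<in> V \<Longrightarrow> D i j \<le> D i k + D k j"
  unfolding semimetric_on_def by blast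

lemma semimetric_on_nonneg:
  assumes "semimetric_on V D" "i \<in> V" "j \<in> V"
  shows "0 \<le> D i j"
  using semimetric_on_triangle[OF assms(1,2,2,3)] semimetric_on_sym[OF assms]
    semimetric_on_refl[OF assms(1,2)] by simp

text \<open>Each pair of distinct non-adjacent vertices has at least 2d + 2 - |U| common neighbours.
  The triangle inequality through each of them bounds its distance by edge lengths at its two ends,
  and summing over all such pairs uses every vertex equally often, by regularity.\<close>

lemma sum_pairs_le_sum_edges:
  fixes D :: "'a \<Rightarrow> 'a \<Rightarrow> real" and N :: "'a \<Rightarrow> 'a set"
  assumes fin: "finite U" and D: "semimetric_on U D"
    and N: "\<And>i. i \<in> U \<Longrightarrow> N i \<subseteq> U - {i}"
    and sym: "\<And>i j. i \<in> U \<Longrightarrow> j \<in> U \<Longrightarrow> j \<in> N i \<longleftrightarrow> i \<in> N j"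
    and deg: "\<And>i. i \<in> U \<Longrightarrow> card (N i) = d"
  shows "(2 * real d + 2 - real (card U)) * (\<Sum>i\<in>U. \<Sum>j\<in>U. D i j)
    \<le> real (card U) * (\<Sum>i\<in>U. \<Sum>j\<in>N i. D i j)"
proof -
  \<comment> \<open>\<open>q\<close> bounds common neighbourhoods from below and may be negative;
    \<open>R i\<close> is the total edge length at \<open>i\<close>; \<open>W i\<close> consists of
    the non-neighbours of \<open>i\<close> other than \<open>i\<close>.\<close>
  define q where "q = 2 * real d + 2 - real (card U)"
  define R where "R i = (\<Sum>k\<in>N i. D i k)" for i
  define W where "W i = U - {i} - N i" for i
  have finN: "finite (N i)" if "i \<in> U" for i
    using N[OF that] fin finite_subset by blast
  have cardW: "real (card (W i)) = real (card U) - 1 - real d" if "i \<in> U" for i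
  proof -
    have "card U = Suc (card (U - {i}))"
      by (rule card.remove[OF fin that])
    moreover have "card (N i) + card (W i) = card (U - {i})"
      unfolding W_def using N[OF that] fin finN[OF that] card_mono[of "U - {i}" "N i"]
      by (simp add: card_Diff_subset)
    ultimately show ?thesis
      using deg[OF that] by linarith
  qed
  have Wsym: "j \<in> W i \<longleftrightarrow> i \<in> W j" if "i \<in> U" "j \<in> U" for i j
    using sym[OF that] that by (auto simp: W_def)
  have nonadj: "q * D i j \<le> R i + R j" if i: "i \<in> U" and j: "j \<in> W i" for i j
  proof -
    have jU: "j \<in> U" and "i \<noteq> j" and "j \<notin> N i" and "i \<notin> N j"
      using j Wsym[OF i] by (auto simp: W_def)
    let ?C = "N i \<inter> N j"
    \<comment> \<open>Neither neighbourhood contains \<open>i\<close> or \<open>j\<close>, so the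
      union has at most |U| - 2 elements and inclusion-exclusion leaves at least 2d - (|U| - 2) =
      \<open>q\<close> common neighbours.\<close>
    have sub: "N i \<union> N j \<subseteq> U - {i, j}"
      using N[OF i] N[OF jU] \<open>j \<notin> N i\<close> \<open>i \<notin> N j\<close> by auto
    have "card (N i \<union> N j) \<le> card (U - {i, j})"
      using sub fin by (intro card_mono) auto
    moreover have "card (U - {i, j}) + 2 = card U"
    proof -
      have "card {i, j} = 2" "{i, j} \<subseteq> U"
        using \<open>i \<noteq> j\<close> i jU by auto
      then show ?thesis
        using card_Diff_subset[of "{i, j}" U] card_mono[OF fin, of "{i, j}"] by simp
    qed
    moreover have "card (N i) + card (N j) = card (N i \<union> N j) + card ?C"
      using finN i jU by (intro card_Un_Int) auto
    ultimately have "q \<le> real (card ?C)"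
      using deg[OF i] deg[OF jU] unfolding q_def by linarith
    then have "q * D i j \<le> real (card ?C) * D i j"
      using semimetric_on_nonneg[OF D i jU] by (rule mult_right_mono)
    also have "\<dots> = (\<Sum>k\<in>?C. D i j)"
      by simp
    also have "\<dots> \<le> (\<Sum>k\<in>?C. D i k + D j k)"
    proof (rule sum_mono)
      fix k assume "k \<in> ?C"
      then have k: "k \<in> U" using N[OF i] by auto
      show "D i j \<le> D i k + D j k"
        using semimetric_on_triangle[OF D i jU k] semimetric_on_sym[OF D jU k] by simp
    qed
    also have "\<dots> = (\<Sum>k\<in>?C. D i k) + (\<Sum>k\<in>?C. D j k)"
      by (rule sum.distrib)
    \<comment> \<open>Enlarging \<open>?C\<close> to \<open>N i\<close> and to \<open>N j\<close>
      only adds nonnegative terms.\<close>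
    also have "\<dots> \<le> R i + R j"
      unfolding R_def
      using N[OF i] N[OF jU]
      by (intro add_mono sum_mono2 finN i jU semimetric_on_nonneg[OF D]) auto
    finally show ?thesis .
  qed
  have split: "(\<Sum>j\<in>U. D i j) = R i + (\<Sum>j\<in>W i. D i j)" if i: "i \<in> U" for i
  proof -
    have "(\<Sum>j\<in>U. D i j) = (\<Sum>j\<in>U - {i}. D i j)"
      using fin i semimetric_on_refl[OF D i] by (simp add: sum.remove)
    also have "\<dots> = (\<Sum>j\<in>U - {i} - N i. D i j) + R i"
      unfolding R_def using fin N[OF i] by (intro sum.subset_diff) auto
    finally show ?thesis by (simp add: W_def)
  qed
  \<comment> \<open>Non-adjacency is symmetric, so the two ends of an ordered non-adjacent pair
    contribute equally in total.\<close>
  have swap: "(\<Sum>i\<in>U. \<Sum>j\<in>W i. R j) = (\<Sum>i\<in>U. \<Sum>j\<in>W i. R i)"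
  proof -
    have W: "W i = {j. j \<in> U \<and> j \<in> W i}" for i
      by (auto simp: W_def)
    have "(\<Sum>i\<in>U. \<Sum>j\<in>W i. R j) = (\<Sum>i\<in>U. \<Sum>j\<in>{j. j \<in> U \<and> j \<in> W i}. R j)"
      using W by simp
    also have "\<dots> = (\<Sum>j\<in>U. \<Sum>i\<in>{i. i \<in> U \<and> j \<in> W i}. R j)"
      by (rule sum.swap_restrict[OF fin fin])
    also have "\<dots> = (\<Sum>j\<in>U. \<Sum>i\<in>W j. R j)"
    proof (rule sum.cong[OF refl])
      fix j assume "j \<in> U"
      then have "{i. i \<in> U \<and> j \<in> W i} = W j"
        using Wsym by (auto simp: W_def)
      then show "(\<Sum>i\<in>{i. i \<in> U \<and> j \<in> W i}. R j) = (\<Sum>i\<in>W j. R j)" by simp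
    qed
    finally show ?thesis .
  qed
  have "q * (\<Sum>i\<in>U. \<Sum>j\<in>W i. D i j) \<le> (\<Sum>i\<in>U. \<Sum>j\<in>W i. R i + R j)"
    unfolding sum_distrib_left by (intro sum_mono nonadj)
  also have "\<dots> = 2 * (\<Sum>i\<in>U. \<Sum>j\<in>W i. R i)"
    by (simp add: sum.distrib swap)
  also have "\<dots> = 2 * (\<Sum>i\<in>U. (real (card U) - 1 - real d) * R i)"
    by (simp add: cardW)
  also have "\<dots> = 2 * (real (card U) - 1 - real d) * (\<Sum>i\<in>U. R i)"
    by (simp only: sum_distrib_left mult.assoc)
  finally have "q * (\<Sum>i\<in>U. \<Sum>j\<in>W i. D i j) \<le> 2 * (real (card U) - 1 - real d) * (\<Sum>i\<in>U. R i)" .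
  moreover have "(\<Sum>i\<in>U. \<Sum>j\<in>U. D i j) = (\<Sum>i\<in>U. R i) + (\<Sum>i\<in>U. \<Sum>j\<in>W i. D i j)"
    by (simp add: split sum.distrib)
  \<comment> \<open>Adding the edges themselves, the coefficient of the sum of \<open>R\<close>
    becomes q + 2 (|U| - 1 - d) = |U|.\<close>
  ultimately have "q * (\<Sum>i\<in>U. \<Sum>j\<in>U. D i j) \<le> real (card U) * (\<Sum>i\<in>U. R i)"
    by (simp add: q_def algebra_simps)
  then show ?thesis
    unfolding q_def R_def .
qed

text \<open>Route each pair \<open>k\<close>, \<open>i\<close> through every neighbour
  \<open>j\<close> of \<open>k\<close> in \<open>A\<close>. A cross edge from \<open>k\<close> to
  \<open>j\<close> then serves all |A| targets \<open>i\<close>, while an inner pair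
  \<open>j\<close>, \<open>i\<close> is used once for each of the \<open>c\<close> neighbours of
  \<open>j\<close> in \<open>B\<close>.\<close>

lemma sum_cross_pairs_le:
  fixes D :: "'a \<Rightarrow> 'a \<Rightarrow> real" and N :: "'a \<Rightarrow> 'a set"
  assumes fin: "finite A" "finite B" and D: "semimetric_on (A \<union> B) D"
    and sym: "\<And>i k. i \<in> A \<Longrightarrow> k \<in> B \<Longrightarrow> i \<in> N k \<longleftrightarrow> k \<in> N i"
    and degA: "\<And>i. i \<in> A \<Longrightarrow> card (N i \<inter> B) = c"
    and degB: "\<And>k. k \<in> B \<Longrightarrow> card (N k \<inter> A) = c"
  shows "real c * (\<Sum>k\<in>B. \<Sum>i\<in>A. D k i)
    \<le> real c * (\<Sum>i\<in>A. \<Sum>j\<in>A. D i j) + real (card A) * (\<Sum>k\<in>B. \<Sum>j\<in>N k \<inter> A. D k j)"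
proof -
  have "real c * (\<Sum>k\<in>B. \<Sum>i\<in>A. D k i) = (\<Sum>k\<in>B. \<Sum>j\<in>N k \<inter> A. \<Sum>i\<in>A. D k i)"
    by (simp add: sum_distrib_left degB)
  also have "\<dots> \<le> (\<Sum>k\<in>B. \<Sum>j\<in>N k \<inter> A. \<Sum>i\<in>A. D k j + D j i)"
    by (intro sum_mono semimetric_on_triangle[OF D]) auto
  also have "\<dots> = (\<Sum>k\<in>B. \<Sum>j\<in>N k \<inter> A. real (card A) * D k j)
      + (\<Sum>k\<in>B. \<Sum>j\<in>N k \<inter> A. \<Sum>i\<in>A. D j i)"
    by (simp add: sum.distrib)
  also have "(\<Sum>k\<in>B. \<Sum>j\<in>N k \<inter> A. \<Sum>i\<in>A. D j i) = real c * (\<Sum>i\<in>A. \<Sum>j\<in>A. D i j)"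
  proof -
    have "(\<Sum>k\<in>B. \<Sum>j\<in>N k \<inter> A. \<Sum>i\<in>A. D j i)
        = (\<Sum>k\<in>B. \<Sum>j\<in>{j. j \<in> A \<and> j \<in> N k}. \<Sum>i\<in>A. D j i)"
      by (simp add: Int_def conj_commute)
    also have "\<dots> = (\<Sum>j\<in>A. \<Sum>k\<in>{k. k \<in> B \<and> j \<in> N k}. \<Sum>i\<in>A. D j i)"
      using fin by (intro sum.swap_restrict)
    also have "\<dots> = (\<Sum>j\<in>A. real c * (\<Sum>i\<in>A. D j i))"
    proof (rule sum.cong[OF refl])
      fix j assume j: "j \<in> A"
      then have "{k. k \<in> B \<and> j \<in> N k} = N j \<inter> B"
        using sym by auto
      then show "(\<Sum>k\<in>{k. k \<in> B \<and> j \<in> N k}. \<Sum>i\<in>A. D j i) = real c * (\<Sum>i\<in>A. D j i)"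
        using degA[OF j] by simp
    qed
    finally show ?thesis by (simp add: sum_distrib_left)
  qed
  finally show ?thesis
    by (simp add: sum_distrib_left)
qed

text \<open>Inner pairs are charged \<open>c\<close> times directly and \<open>c\<close> times more
  by the cross pairs. The degree condition says exactly that 2c is at most 2d + 2 - m, so the inner
  edges can pay for both.\<close>

lemma sum_edges_lower_bound:
  fixes D :: "'a \<Rightarrow> 'a \<Rightarrow> real" and N :: "'a \<Rightarrow> 'a set"
  assumes fin: "finite A" "finite B" and disj: "A \<inter> B = {}"
    and cardA: "card A = m" and cardB: "card B = m"
    and D: "semimetric_on (A \<union> B) D"
    and N: "\<And>i. i \<in> A \<union> B \<Longrightarrow> N i \<subseteq> A \<union> B - {i}"
    and sym: "\<And>i j. j \<in> N i \<longleftrightarrow> i \<in> N j"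
    and inA: "\<And>i. i \<in> A \<Longrightarrow> card (N i \<inter> A) = d"
    and inB: "\<And>i. i \<in> B \<Longrightarrow> card (N i \<inter> B) = d"
    and outA: "\<And>i. i \<in> A \<Longrightarrow> card (N i \<inter> B) = c"
    and outB: "\<And>i. i \<in> B \<Longrightarrow> card (N i \<inter> A) = c"
    and deg: "real d - real c \<ge> real m / 2 - 1"
  shows "real c * (\<Sum>i\<in>A \<union> B. \<Sum>j\<in>A \<union> B. D i j)
    \<le> real m * (\<Sum>i\<in>A \<union> B. \<Sum>j\<in>N i. D i j)"
proof -
  let ?q = "2 * real d + 2 - real m"
  let ?T = "\<lambda>X Y. \<Sum>i\<in>X. \<Sum>j\<in>Y. D i j"
  let ?E = "\<lambda>X Y. \<Sum>i\<in>X. \<Sum>j\<in>N i \<inter> Y. D i j"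
  have DA: "semimetric_on A D" and DB: "semimetric_on B D"
    using D by (auto intro: semimetric_on_subset)
  have "?q * ?T A A \<le> real m * ?E A A"
    using sum_pairs_le_sum_edges[OF fin(1) DA, of "\<lambda>i. N i \<inter> A" d] N sym inA cardA by auto
  moreover have "?q * ?T B B \<le> real m * ?E B B"
    using sum_pairs_le_sum_edges[OF fin(2) DB, of "\<lambda>i. N i \<inter> B" d] N sym inB cardB by auto
  moreover have "2 * real c * ?T A A \<le> ?q * ?T A A" "2 * real c * ?T B B \<le> ?q * ?T B B"
    using deg semimetric_on_nonneg[OF DA] semimetric_on_nonneg[OF DB]
    by (auto intro!: mult_right_mono sum_nonneg)
  moreover have "real c * ?T B A \<le> real c * ?T A A + real m * ?E B A"
    using sum_cross_pairs_le[OF fin D, of N c] sym outA outB cardA by auto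
  \<comment> \<open>All sums run over ordered pairs, so the cross bound is applied in both
    directions; this spreads the charge evenly over the inner pairs of \<open>A\<close> and of
    \<open>B\<close>.\<close>
  moreover have "real c * ?T A B \<le> real c * ?T B B + real m * ?E A B"
    using sum_cross_pairs_le[of B A D N c] fin D sym outA outB cardB by (auto simp: Un_commute)
  ultimately have "real c * (?T A A + ?T A B + ?T B A + ?T B B)
      \<le> real m * (?E A A + ?E A B + ?E B A + ?E B B)"
    by (simp add: distrib_left)
  moreover have "?T (A \<union> B) (A \<union> B) = ?T A A + ?T A B + ?T B A + ?T B B"
    using fin disj by (simp add: sum.union_disjoint sum.distrib)
  moreover have "(\<Sum>i\<in>A \<union> B. \<Sum>j\<in>N i. D i j) = ?E A A + ?E A B + ?E B A + ?E B B"
  proof -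
    have "(\<Sum>j\<in>N i. D i j) = (\<Sum>j\<in>N i \<inter> A. D i j) + (\<Sum>j\<in>N i \<inter> B. D i j)"
      if "i \<in> A \<union> B" for i
    proof -
      have "N i = (N i \<inter> A) \<union> (N i \<inter> B)"
        using N[OF that] by auto
      then have "(\<Sum>j\<in>N i. D i j) = (\<Sum>j\<in>(N i \<inter> A) \<union> (N i \<inter> B). D i j)"
        by simp
      also have "\<dots> = (\<Sum>j\<in>N i \<inter> A. D i j) + (\<Sum>j\<in>N i \<inter> B. D i j)"
        using fin disj by (intro sum.union_disjoint) auto
      finally show ?thesis .
    qed
    then show ?thesis
      using fin disj by (simp add: sum.union_disjoint sum.distrib)
  qed
  ultimately show ?thesis by simp
qed

section \<open>The linear program\<close>

text \<open>For \<open>i = j\<close> the set \<open>{i, j}\<close> is a singleton and not a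
  coordinate of the program, so the diagonal is set to 0 explicitly.\<close>

definition pair_dist :: "('a set \<Rightarrow> real) \<Rightarrow> 'a \<Rightarrow> 'a \<Rightarrow> real" where
  "pair_dist x i j = (if i = j then 0 else x {i, j})"

lemma sum_pair_dist:
  assumes "finite V"
  shows "(\<Sum>i\<in>V. \<Sum>j\<in>V. pair_dist x i j) = 2 * (\<Sum>e\<in>nsets V 2. x e)"
proof -
  have "(\<Sum>j\<in>V. pair_dist x i j) = (\<Sum>j\<in>V - {i}. x {i, j})" if "i \<in> V" for i
  proof -
    have "(\<Sum>j\<in>V. pair_dist x i j) = (\<Sum>j\<in>V - {i}. pair_dist x i j)"
      using assms that by (simp add: sum.remove pair_dist_def)
    also have "\<dots> = (\<Sum>j\<in>V - {i}. x {i, j})"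
      by (intro sum.cong refl) (auto simp: pair_dist_def)
    finally show ?thesis .
  qed
  then show ?thesis
    using assms by (simp add: sum_nsets_2)
qed

lemma lp_objective_eq_sum_nbrs:
  assumes "E \<subseteq> nsets {1..n} 2"
  shows "2 * lp_objective n E x = (\<Sum>i\<in>{1..n}. \<Sum>j\<in>nbrs E i. pair_dist x i j)"
proof -
  have "(\<Sum>j\<in>{1..n} - {i}. (if {i, j} \<in> E then 1 else 0) * x {i, j})
      = (\<Sum>j\<in>nbrs E i. pair_dist x i j)" for i
  proof (rule sum.mono_neutral_cong_right)
    show "nbrs E i \<subseteq> {1..n} - {i}"
      using assms by (rule nbrs_subset)
    then show "\<And>j. j \<in> nbrs E i \<Longrightarrow> (if {i, j} \<in> E then 1 else 0) * x {i, j} = pair_dist x i j"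
      by (auto simp: nbrs_def pair_dist_def)
  qed (auto simp: nbrs_def)
  then show ?thesis
    by (simp add: lp_objective_def sum_nsets_2)
qed

text \<open>The program states triangle inequalities only for distinct indices with
  \<open>i < j\<close> and has no sign constraints. Symmetry removes the ordering, and a third
  vertex yields nonnegativity.\<close>

lemma lp_feasible_semimetric:
  assumes n: "n \<ge> 3" and x: "lp_feasible n x"
  shows "semimetric_on {1..n} (pair_dist x)"
proof -
  have ordered: "x {i, j} \<le> x {i, k} + x {j, k}"
    if "i \<in> {1..n}" "j \<in> {1..n}" "k \<in> {1..n}" "i < j" "k \<noteq> i" "k \<noteq> j" for i j k
    using x that unfolding lp_feasible_def by blast
  have tri: "x {i, j} \<le> x {i, k} + x {k, j}"
    if "i \<in> {1..n}" "j \<in> {1..n}" "k \<in> {1..n}" "i \<noteq> j" "k \<noteq> i" "k \<noteq> j" for i j k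
  proof (cases "i < j")
    case True
    then show ?thesis
      using ordered[of i j k] that by (simp add: insert_commute)
  next
    case False
    then show ?thesis
      using ordered[of j i k] that by (simp add: insert_commute)
  qed
  have nonneg: "0 \<le> x {i, k}" if "i \<in> {1..n}" "k \<in> {1..n}" "i \<noteq> k" for i k
  proof -
    have "\<not> {1..n} \<subseteq> {i, k}"
    proof
      assume "{1..n} \<subseteq> {i, k}"
      then have "card {1..n} \<le> card {i, k}"
        by (intro card_mono) auto
      then show False
        using n that(3) by simp
    qed
    then obtain l where "l \<in> {1..n}" "l \<noteq> i" "l \<noteq> k"
      by blast
    \<comment> \<open>Adding the triangle inequalities for \<open>{i, l}\<close> through
      \<open>k\<close> and for \<open>{k, l}\<close> through \<open>i\<close> cancels both distances
      to \<open>l\<close> and leaves 0 \<le> 2 \<open>x {i, k}\<close>.\<close>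
    then show ?thesis
      using tri[of i l k] tri[of k l i] that by (simp add: insert_commute)
  qed
  show ?thesis
    unfolding semimetric_on_def pair_dist_def
    using tri nonneg by (auto simp: insert_commute)
qed

section \<open>Values and feasibility of the cut vector\<close>

lemma cut_vector_cross:
  assumes "V\<^sub>1 \<union> V\<^sub>2 = {1..n}" "V\<^sub>1 \<inter> V\<^sub>2 = {}" "i \<in> {1..n}" "j \<in> {1..n}" "i \<noteq> j"
  shows "cut_vector n V\<^sub>1 V\<^sub>2 {i, j} = (if i \<in> V\<^sub>1 \<longleftrightarrow> j \<in> V\<^sub>1 then 0 else 1)"
proof -
  have "{i, j} \<in> nsets {1..n} 2"
    using assms by (simp add: nsets_def)
  moreover have "{i, j} \<subseteq> V\<^sub>1 \<or> {i, j} \<subseteq> V\<^sub>2 \<longleftrightarrow> (i \<in> V\<^sub>1 \<longleftrightarrow> j \<in> V\<^sub>1)"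
    using assms(1-4) by blast
  ultimately show ?thesis
    by (simp add: cut_vector_def)
qed

lemma pair_dist_cut_vector:
  assumes "V\<^sub>1 \<union> V\<^sub>2 = {1..n}" "V\<^sub>1 \<inter> V\<^sub>2 = {}" "i \<in> {1..n}" "j \<in> {1..n}"
  shows "pair_dist (cut_vector n V\<^sub>1 V\<^sub>2) i j = (if i \<in> V\<^sub>1 \<longleftrightarrow> j \<in> V\<^sub>1 then 0 else 1)"
  using cut_vector_cross[OF assms] by (auto simp: pair_dist_def)

text \<open>Used twice: with \<open>S\<close> the whole vertex set for the equality constraint, and
  with \<open>S\<close> a neighbourhood for the objective value.\<close>

lemma sum_pair_dist_cut_vector:
  assumes V: "V\<^sub>1 \<union> V\<^sub>2 = {1..n}" "V\<^sub>1 \<inter> V\<^sub>2 = {}" and i: "i \<in> {1..n}" and S: "S \<subseteq> {1..n}"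
  shows "(\<Sum>j\<in>S. pair_dist (cut_vector n V\<^sub>1 V\<^sub>2) i j)
    = real (card (S \<inter> (if i \<in> V\<^sub>1 then V\<^sub>2 else V\<^sub>1)))"
proof -
  let ?X = "if i \<in> V\<^sub>1 then V\<^sub>2 else V\<^sub>1"
  have "finite S"
    using S finite_subset by blast
  have "(\<Sum>j\<in>S. pair_dist (cut_vector n V\<^sub>1 V\<^sub>2) i j) = (\<Sum>j\<in>S. if j \<in> ?X then 1 else 0)"
    using V S i by (intro sum.cong refl) (auto simp: pair_dist_cut_vector subset_iff)
  also have "\<dots> = real (card (S \<inter> ?X))"
    using \<open>finite S\<close> by (simp add: sum.If_cases)
  finally show ?thesis .
qed

lemma lp_feasible_cut_vector:
  assumes V: "V\<^sub>1 \<union> V\<^sub>2 = {1..n}" "V\<^sub>1 \<inter> V\<^sub>2 = {}"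
    and card: "card V\<^sub>1 = m" "card V\<^sub>2 = m" and n: "n = 2 * m"
  shows "lp_feasible n (cut_vector n V\<^sub>1 V\<^sub>2)"
proof -
  let ?x = "cut_vector n V\<^sub>1 V\<^sub>2"
  have "(\<Sum>i\<in>{1..n}. \<Sum>j\<in>{1..n}. pair_dist ?x i j) = (\<Sum>i\<in>{1..n}. real m)"
  proof (rule sum.cong[OF refl])
    fix i assume i: "i \<in> {1..n}"
    have "{1..n} \<inter> V\<^sub>1 = V\<^sub>1" "{1..n} \<inter> V\<^sub>2 = V\<^sub>2"
      using V(1) by auto
    then show "(\<Sum>j\<in>{1..n}. pair_dist ?x i j) = real m"
      using card by (simp only: sum_pair_dist_cut_vector[OF V i subset_refl]) simp
  qed
  then have "(\<Sum>e\<in>nsets {1..n} 2. ?x e) = (real n)\<^sup>2 / 4"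
    using n by (simp add: sum_pair_dist power2_eq_square)
  moreover have "?x \<in> nsets {1..n} 2 \<rightarrow>\<^sub>E UNIV"
    by (auto simp: cut_vector_def)
  ultimately show ?thesis
    \<comment> \<open>Among three vertices the cut separates either no pair or exactly two pairs,
      which gives both families of inequalities.\<close>
    unfolding lp_feasible_def by (auto simp: cut_vector_cross[OF V])
qed

section \<open>Optimality of the planted cut\<close>

theorem proposition1:
  fixes n d_in d_out :: nat and E :: "nat set set" and V\<^sub>1 V\<^sub>2 :: "nat set"
  assumes "n \<ge> 4"
    and "simple_graph {1..n} E"
    and "bisection {1..n} V\<^sub>1 V\<^sub>2"
    and "d_in \<in> {1..n div 2 - 1}"
    and "d_out \<in> {0..n div 2}"
    and "regular V\<^sub>1 (induced_edges E V\<^sub>1) d_in"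
    and "regular V\<^sub>2 (induced_edges E V\<^sub>2) d_in"
    and "regular {1..n} (edges_between E V\<^sub>1 V\<^sub>2) d_out"
    and "real d_in - real d_out \<ge> real n / 4 - 1"
  shows "lp_optimal n E (cut_vector n V\<^sub>1 V\<^sub>2)"
proof -
  let ?c = "cut_vector n V\<^sub>1 V\<^sub>2"
  define m where "m = card V\<^sub>1"
  have V: "V\<^sub>1 \<union> V\<^sub>2 = {1..n}" "V\<^sub>1 \<inter> V\<^sub>2 = {}" and card: "card V\<^sub>1 = m" "card V\<^sub>2 = m"
    using assms(3) by (auto simp: bisection_def m_def)
  have sub: "V\<^sub>1 \<subseteq> {1..n}" "V\<^sub>2 \<subseteq> {1..n}"
    using V(1) by auto
  have fin: "finite V\<^sub>1" "finite V\<^sub>2"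
    using sub finite_subset by blast+
  have n: "n = 2 * m"
    using card_Un_disjoint[OF fin V(2)] V(1) card by simp
  have E: "E \<subseteq> nsets {1..n} 2"
    using assms(2) by (simp add: simple_graph_def)
  have out1: "card (nbrs E i \<inter> V\<^sub>2) = d_out" if "i \<in> V\<^sub>1" for i
    using card_nbrs_between[OF E assms(8) V(2) sub(1) that] .
  have out2: "card (nbrs E i \<inter> V\<^sub>1) = d_out" if "i \<in> V\<^sub>2" for i
    using card_nbrs_between[OF E _ _ sub(2) that, of V\<^sub>1] assms(8) V(2)
    by (simp add: edges_between_commute Int_commute)
  \<comment> \<open>Every vertex has exactly \<open>d_out\<close> neighbours across the cut; the
    factor 2 counts each cut edge from both ends.\<close>
  have opt: "2 * lp_objective n E ?c = real n * real d_out"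
  proof -
    have "(\<Sum>j\<in>nbrs E i. pair_dist ?c i j) = real d_out" if i: "i \<in> {1..n}" for i
    proof -
      have "nbrs E i \<subseteq> {1..n}"
        using nbrs_subset[OF E] by blast
      moreover have "i \<in> V\<^sub>2" if "i \<notin> V\<^sub>1"
        using i V(1) that by blast
      ultimately show ?thesis
        using out1 out2 by (simp add: sum_pair_dist_cut_vector[OF V i])
    qed
    then show ?thesis
      by (simp add: lp_objective_eq_sum_nbrs[OF E])
  qed
  have "lp_objective n E ?c \<le> lp_objective n E x" if x: "lp_feasible n x" for x
  proof -
    have D: "semimetric_on (V\<^sub>1 \<union> V\<^sub>2) (pair_dist x)"
      using lp_feasible_semimetric[OF _ x] assms(1) V(1) by simp
    \<comment> \<open>The equality constraint fixes the sum over unordered pairs to n^2/4 =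
      m^2.\<close>
    have total: "(\<Sum>i\<in>{1..n}. \<Sum>j\<in>{1..n}. pair_dist x i j) = 2 * (real m)\<^sup>2"
      using x n by (simp add: sum_pair_dist lp_feasible_def power2_eq_square)
    have "real d_out * (\<Sum>i\<in>V\<^sub>1 \<union> V\<^sub>2. \<Sum>j\<in>V\<^sub>1 \<union> V\<^sub>2. pair_dist x i j)
        \<le> real m * (\<Sum>i\<in>V\<^sub>1 \<union> V\<^sub>2. \<Sum>j\<in>nbrs E i. pair_dist x i j)"
    proof (rule sum_edges_lower_bound[OF fin V(2) card D])
      show "nbrs E i \<subseteq> V\<^sub>1 \<union> V\<^sub>2 - {i}" for i
        using nbrs_subset[OF E] V(1) by simp
      show "real m / 2 - 1 \<le> real d_in - real d_out"
        using assms(9) n by simp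
    qed (fact nbrs_sym out1 out2 card_nbrs_induced[OF E assms(6)]
        card_nbrs_induced[OF E assms(7)])+
    \<comment> \<open>Since n = 2m, the left side \<open>d_out\<close> * 2m^2 is m times the doubled
      value of the cut vector; the factor m is positive and cancels.\<close>
    then have "real m * (real n * real d_out) \<le> real m * (2 * lp_objective n E x)"
      unfolding V(1) total lp_objective_eq_sum_nbrs[OF E]
      using n by (simp add: power2_eq_square algebra_simps)
    then show ?thesis
      using opt n assms(1) by simp
  qed
  moreover have "lp_feasible n ?c"
    using lp_feasible_cut_vector[OF V card n] .
  ultimately show ?thesis
    unfolding lp_optimal_def is_arg_min_def by (auto simp: not_less)
qed

end
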